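(* For every integer $n\ge 2$, $$\sum_{r=1}^{n-1} \frac{(-1)^r B_r}{r} \sum_{l=r}^n \frac{(-1)^l}{l}\binom{n-1}{n-l} = -\frac{1}{n^2}.$$
   Context: $B_r$ are the Bernoulli numbers defined by $\frac{t}{e^t-1}=\sum_r B_r\frac{t^r}{r!}$ (so $B_1=-\frac12$). *)

theory Defs
  imports Complex_Main "HOL-Computational_Algebra.Formal_Power_Series"
begin

text \<open>
  Division of formal power series cancels common powers of the indeterminate, so the quotient
  below is a genuine one although the denominator has zero constant term; this is
  what \<open>bernoulli_egf\<close> records.
\<close>
definition bernoulli :: "nat \<Rightarrow> real" where
  "bernoulli r = fact r * fps_nth (fps_X / (fps_exp 1 - 1)) r"

lemma bernoulli_egf:
  "Abs_fps (\<lambda>r. bernoulli r / fact r) * (fps_exp 1 - 1) = fps_X"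
proof -
  have nth1: "fps_nth (fps_exp (1::real) - 1) 1 = 1"
    by simp
  have "subdegree (fps_exp (1::real) - 1) = 1"
    by (rule subdegreeI) (use nth1 in auto)
  moreover have "fps_exp (1::real) - 1 \<noteq> 0"
    using nth1 by auto
  ultimately have "(fps_exp (1::real) - 1) dvd fps_X"
    by (simp add: fps_dvd_iff)
  then have "fps_X / (fps_exp (1::real) - 1) * (fps_exp 1 - 1) = fps_X"
    by (rule dvd_div_mult_self)
  moreover have "Abs_fps (\<lambda>r. bernoulli r / fact r) = fps_X / (fps_exp 1 - 1)"
    by (simp add: fps_eq_iff bernoulli_def)
  ultimately show ?thesis
    by simp
qed

lemma bernoulli_0: "bernoulli 0 = 1"
  using arg_cong[OF bernoulli_egf, of "\<lambda>f. fps_nth f 1"]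
  by (simp add: fps_mult_nth)

lemma bernoulli_1: "bernoulli 1 = - 1 / 2"
  using arg_cong[OF bernoulli_egf, of "\<lambda>f. fps_nth f 2"] bernoulli_0
  by (simp add: fps_mult_nth numeral_2_eq_2)

end

theory Submission
  imports Defs
begin

text \<open>
  Absorption, \<open>binomial (n - 1) (l - 1) / l = binomial n l / n\<close>, turns the inner sum into \<open>1 / n\<close> times a tail of
  the alternating sum of the \<open>n\<close>-th binomial row. Such a tail collapses to the single term
  \<open>(- 1) ^ r * binomial (n - 1) (r - 1)\<close>, whose sign cancels the outer \<open>(- 1) ^ r\<close>. Absorbing the
  factor \<open>1 / r\<close> in the same way leaves \<open>1 / n\<^sup>2\<close> times the sum of \<open>binomial n r * B r\<close> over
  \<open>1 \<le> r < n\<close>. By the classical recurrence that sum is \<open>- B 0 = - 1\<close>.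
\<close>

text \<open>
  Comparing coefficients of \<open>t ^ n\<close> in the defining identity of the exponential generating function;
  the right-hand side \<open>t\<close> contributes nothing because \<open>n \<ge> 2\<close>.
\<close>
lemma bernoulli_recurrence:
  assumes "n \<ge> 2"
  shows "(\<Sum>r<n. real (n choose r) * bernoulli r) = 0"
proof -
  have "0 = fps_nth (Abs_fps (\<lambda>r. bernoulli r / fact r) * (fps_exp 1 - 1)) n"
    using assms by (simp add: bernoulli_egf)
  also have "\<dots> = (\<Sum>r\<le>n. bernoulli r / fact r * fps_nth (fps_exp 1 - 1) (n - r))"
    by (simp add: fps_mult_nth atLeast0AtMost)
  also have "\<dots> = (\<Sum>r<n. bernoulli r / fact r * fps_nth (fps_exp 1 - 1) (n - r))"
    by (simp add: mult.commute flip: lessThan_Suc_atMost)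
  also have "\<dots> = (\<Sum>r<n. real (n choose r) * bernoulli r / fact n)"
    by (intro sum.cong refl) (simp add: binomial_fact field_simps)
  also have "\<dots> = (\<Sum>r<n. real (n choose r) * bernoulli r) / fact n"
    by (simp add: sum_divide_distrib)
  finally show ?thesis
    by simp
qed

lemma binomial_absorption_divide:
  assumes "k \<ge> 1" and "k \<le> n"
  shows "real ((n - 1) choose (k - 1)) / real k = real (n choose k) / real n"
proof -
  have "real k * real (n choose k) = real n * real ((n - 1) choose (k - 1))"
    using times_binomial_minus1_eq[of k n] assms by (metis of_nat_mult less_le_trans zero_less_one)
  then show ?thesis
    using assms by (simp add: field_simps)
qed

text \<open>
  By Pascal's rule each term of the alternating row is a difference of neighbouring entries of the
  previous row, so the tail telescopes.
\<close>
lemma alternating_binomial_tail: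
  assumes "r \<ge> 1" and "r \<le> n"
  shows "(\<Sum>l = r..n. (- 1) ^ l * real (n choose l)) = (- 1) ^ r * real ((n - 1) choose (r - 1))"
proof -
  define f where "f l = (- 1) ^ l * real ((n - 1) choose (l - 1))" for l
  have "(- 1) ^ l * real (n choose l) = f l - f (Suc l)" if "l \<in> {r..n}" for l
    using that assms choose_reduce_nat[of n l] by (simp add: f_def algebra_simps)
  then have "(\<Sum>l = r..n. (- 1) ^ l * real (n choose l)) = (\<Sum>l = r..n. f l - f (Suc l))"
    by (intro sum.cong refl) auto
  also have "\<dots> = f r - f (Suc n)"
    using sum_Suc_diff[of r "n" f] assms by (simp add: sum_subtractf)
  also have "f (Suc n) = 0"
    using assms by (simp add: f_def)
  finally show ?thesis
    by (simp add: f_def)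
qed

theorem mainTheorem20:
  fixes n :: nat
  assumes "n \<ge> 2"
  shows "(\<Sum>r = 1..n - 1. (- 1) ^ r * bernoulli r / real r *
            (\<Sum>l = r..n. (- 1) ^ l / real l * real ((n - 1) choose (n - l)))) =
         - 1 / (real n)\<^sup>2"
proof -
  have inner: "(\<Sum>l = r..n. (- 1) ^ l / real l * real ((n - 1) choose (n - l))) =
      (- 1) ^ r * real ((n - 1) choose (r - 1)) / real n" if "r \<ge> 1" "r \<le> n" for r
  proof -
    have "(- 1) ^ l / real l * real ((n - 1) choose (n - l)) =
        (- 1) ^ l * real (n choose l) / real n" if "l \<in> {r..n}" for l
    proof -
      have "l \<ge> 1" "l \<le> n"
        using that \<open>r \<ge> 1\<close> by auto
      moreover from this have "(n - 1) choose (n - l) = (n - 1) choose (l - 1)"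
        using binomial_symmetric[of "l - 1" "n - 1"] by simp
      ultimately show ?thesis
        using binomial_absorption_divide[of l n] by (simp add: field_simps)
    qed
    then have "(\<Sum>l = r..n. (- 1) ^ l / real l * real ((n - 1) choose (n - l))) =
        (\<Sum>l = r..n. (- 1) ^ l * real (n choose l)) / real n"
      unfolding sum_divide_distrib by (intro sum.cong refl) auto
    with alternating_binomial_tail[OF that] show ?thesis
      by simp
  qed
  have "(- 1) ^ r * bernoulli r / real r *
      (\<Sum>l = r..n. (- 1) ^ l / real l * real ((n - 1) choose (n - l))) =
      real (n choose r) * bernoulli r / (real n)\<^sup>2" if "r \<in> {1..n - 1}" for r
  proof -
    have r: "r \<ge> 1" "r \<le> n"
      using that by auto
    have "(- 1) ^ r * bernoulli r / real r * ((- 1) ^ r * real ((n - 1) choose (r - 1)) / real n) =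
        ((- 1) ^ r * (- 1) ^ r) * bernoulli r * (real ((n - 1) choose (r - 1)) / real r) / real n"
      by simp
    also have "\<dots> = real (n choose r) * bernoulli r / (real n)\<^sup>2"
      unfolding binomial_absorption_divide[OF r]
      by (simp add: power2_eq_square flip: power_mult_distrib)
    finally show ?thesis
      unfolding inner[OF r] .
  qed
  then have "(\<Sum>r = 1..n - 1. (- 1) ^ r * bernoulli r / real r *
      (\<Sum>l = r..n. (- 1) ^ l / real l * real ((n - 1) choose (n - l)))) =
      (\<Sum>r = 1..n - 1. real (n choose r) * bernoulli r) / (real n)\<^sup>2"
    unfolding sum_divide_distrib by (intro sum.cong refl) auto
  also have "(\<Sum>r = 1..n - 1. real (n choose r) * bernoulli r) = - 1"
  proof -
    have "{..<n} = insert 0 {1..n - 1}"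
      using assms by auto
    with bernoulli_recurrence[OF assms] show ?thesis
      by (simp add: bernoulli_0)
  qed
  finally show ?thesis .
qed

end
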